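(* Let $k\ge 1$ and $n\ge 1$ be integers. The number of $k$-Schröder paths of type B of size $n$ is given by $$|\mathtt{Sch}^{B}(n;k)|=\frac{1}{n}\sum_{m=0}^{n-1}2^{m+1}\binom{nk}{m}\binom{n}{n-m-1},$$ and also by $$|\mathtt{Sch}^{B}(n;k)|=\frac{1}{n}\sum_{j=0}^{n}\binom{n}{j}\binom{kn+j}{n-1}.$$
   Context: A $k$-Schröder path of type B of size $n$ is a lattice path from $(0,0)$ to $(kn,n)$ consisting of up steps $U=(0,1)$, down steps $D=(1,0)$ and horizontal steps $H=(1,1)$, which never goes below the line $y=x/k$. The set of such paths is denoted $\mathtt{Sch}^{B}(n;k)$. *)

theory Defs
  imports Complex_Main
begin

datatype step = Up | Down | Horiz

fun step_vec :: "step \<Rightarrow> nat \<times> nat" where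
  "step_vec Up = (0, 1)"
| "step_vec Down = (1, 0)"
| "step_vec Horiz = (1, 1)"

text \<open>A lattice path starting at the origin is identified with its list of steps;
  \<open>endpoint p\<close> is the lattice point in which it ends.\<close>

definition endpoint :: "step list \<Rightarrow> nat \<times> nat" where
  "endpoint p = (\<Sum>s\<leftarrow>p. fst (step_vec s), \<Sum>s\<leftarrow>p. snd (step_vec s))"

text \<open>It suffices to test the lattice points visited by the path (the endpoints of its prefixes),
  as the region on or above a line is convex and steps are straight segments.\<close>

definition never_below :: "nat \<Rightarrow> step list \<Rightarrow> bool" where
  "never_below k p \<longleftrightarrow>
     (\<forall>i\<le>length p. real (snd (endpoint (take i p))) \<ge> real (fst (endpoint (take i p))) / real k)"

definition SchB :: "nat \<Rightarrow> nat \<Rightarrow> step list set" where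
  "SchB n k = {p. endpoint p = (k * n, n) \<and> never_below k p}"

end

(* Read a path by its height k y - x above the line. Started at an arbitrary height h and stopped
   at height 0, the nonnegative paths with a steps U and b steps H are counted by the ballot number
   (h + 1) s! / (a! b! (h + 1 + k a + (k - 1) b)!), where s = h + (k + 1) a + k b is the number of
   steps: these numbers satisfy the recursion obtained by deleting the first step. Taking h = 0
   and summing over a + b = n gives the second formula; expanding the binomial coefficient by
   Vandermonde gives the first. *)

theory Submission
  imports Defs
begin

text \<open>The argument \<open>h\<close> is the current height k y - x. For k \<ge> 1 only
  \<open>Down\<close> lowers it, so positivity is tested there alone, and \<open>h + k - 1\<close>
  is never truncated.\<close>

fun descends :: "nat \<Rightarrow> nat \<Rightarrow> step list \<Rightarrow> bool" where
  "descends k h [] \<longleftrightarrow> h = 0"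
| "descends k h (Up # p) \<longleftrightarrow> descends k (h + k) p"
| "descends k h (Horiz # p) \<longleftrightarrow> descends k (h + k - 1) p"
| "descends k h (Down # p) \<longleftrightarrow> h > 0 \<and> descends k (h - 1) p"

lemma endpoint_Nil [simp]: "endpoint [] = (0, 0)"
  by (simp add: endpoint_def)

lemma endpoint_Cons [simp]:
  "endpoint (s # p) = (fst (step_vec s) + fst (endpoint p), snd (step_vec s) + snd (endpoint p))"
  by (simp add: endpoint_def)

lemma all_le_Suc_iff: "(\<forall>i\<le>Suc m. P i) \<longleftrightarrow> P 0 \<and> (\<forall>i\<le>m. P (Suc i))"
  by (metis Suc_le_mono bot_nat_0.extremum not0_implies_Suc)

text \<open>Translates heights back into coordinates: a path started at height \<open>h\<close> has
  height h + k y - x after each prefix. The induction leaves \<open>h\<close> arbitrary because the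
  first step changes it.\<close>

lemma descends_iff:
  assumes "k \<ge> 1"
  shows "descends k h p \<longleftrightarrow> fst (endpoint p) = h + k * snd (endpoint p) \<and>
    (\<forall>i\<le>length p. fst (endpoint (take i p)) \<le> h + k * snd (endpoint (take i p)))"
proof (induction p arbitrary: h)
  case Nil
  then show ?case by auto
next
  case (Cons s p)
  show ?case
  proof (cases s)
    case Up
    then show ?thesis
      by (simp add: Cons.IH all_le_Suc_iff add.assoc)
  next
    case Horiz
    have "Suc x = h + (k + k * y) \<longleftrightarrow> x = h + k - 1 + k * y"
      and "Suc x \<le> h + (k + k * y) \<longleftrightarrow> x \<le> h + k - 1 + k * y" for x y
      using assms by linarith+
    then show ?thesis
      using Horiz by (simp add: Cons.IH all_le_Suc_iff)
  next
    case Down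
    show ?thesis
    proof (cases h)
      case 0
      then show ?thesis
        \<comment> \<open>Index 0 in the tail \<open>p\<close> stands for the prefix consisting of
          the initial \<open>Down\<close>, which ends in (1, 0) and already lies below the
          line.\<close>
        using Down by (auto intro!: exI[of _ 0] simp: all_le_Suc_iff)
    next
      case (Suc g)
      then show ?thesis
        using Down by (simp add: Cons.IH all_le_Suc_iff)
    qed
  qed
qed

lemma never_below_iff:
  assumes "k \<ge> 1"
  shows "never_below k p \<longleftrightarrow>
    (\<forall>i\<le>length p. fst (endpoint (take i p)) \<le> k * snd (endpoint (take i p)))"
proof -
  have "real x / real k \<le> real y \<longleftrightarrow> x \<le> k * y" for x y
  proof -
    have "real x / real k \<le> real y \<longleftrightarrow> real x \<le> real (k * y)"
      using assms by (simp add: divide_le_eq mult.commute)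
    then show ?thesis
      by (simp only: of_nat_le_iff)
  qed
  then show ?thesis
    unfolding never_below_def by simp
qed

lemma snd_endpoint: "snd (endpoint p) = count_list p Up + count_list p Horiz"
proof (induction p)
  case (Cons s p)
  then show ?case by (cases s) auto
qed simp

lemma SchB_eq:
  assumes "k \<ge> 1"
  shows "SchB n k = {p. descends k 0 p \<and> count_list p Up + count_list p Horiz = n}"
  using assms
  by (auto simp: SchB_def descends_iff never_below_iff prod_eq_iff simp flip: snd_endpoint)

text \<open>The number of \<open>Down\<close> steps need not be recorded: ending at height 0 forces
  it to be h + k a + (k - 1) b.\<close>

definition descents :: "nat \<Rightarrow> nat \<Rightarrow> nat \<Rightarrow> nat \<Rightarrow> step list set" where
  "descents k h a b = {p. descends k h p \<and> count_list p Up = a \<and> count_list p Horiz = b}"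

lemma descents_0: "descents k 0 0 0 = {[]}"
proof -
  have "p = []" if "p \<in> descents k 0 0 0" for p
  proof (cases p)
    case (Cons s q)
    then show ?thesis
      using that by (cases s) (auto simp: descents_def)
  qed
  then show ?thesis
    by (auto simp: descents_def)
qed

text \<open>The paths are sorted by their first step; the excluded triple is the only one that
  admits the empty path.\<close>

lemma descents_rec:
  assumes "(h, a, b) \<noteq> (0, 0, 0)"
  shows "descents k h a b =
      (if a = 0 then {} else (#) Up ` descents k (h + k) (a - 1) b) \<union>
      (if b = 0 then {} else (#) Horiz ` descents k (h + k - 1) a (b - 1)) \<union>
      (if h = 0 then {} else (#) Down ` descents k (h - 1) a b)" (is "_ = ?R")
proof (rule set_eqI)
  fix p
  show "p \<in> descents k h a b \<longleftrightarrow> p \<in> ?R"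
  proof (cases p)
    case Nil
    then show ?thesis
      using assms by (auto simp: descents_def)
  next
    case (Cons s q)
    then show ?thesis
      by (cases s) (auto simp: descents_def image_iff)
  qed
qed

text \<open>Induction on the number of steps, which is the argument of the factorial in the
  numerator. Finiteness is carried along because adding the cardinalities of the three classes
  requires it.\<close>

lemma card_descents:
  fixes h a b k :: nat
  assumes "k \<ge> 1"
  shows "finite (descents k h a b) \<and>
    real (card (descents k h a b)) = real (h + 1) * fact (h + (k + 1) * a + k * b) /
      (fact a * fact b * fact (h + 1 + k * a + (k - 1) * b))"
proof (induction "h + (k + 1) * a + k * b" arbitrary: h a b rule: less_induct)
  case less
  show ?case
  proof (cases "(h, a, b) = (0, 0, 0)")
    case True
    then show ?thesis
      by (simp add: descents_0)
  next
    case False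
    obtain q where k: "k = Suc q"
      using assms by (cases k) auto
    define s where "s = h + (k + 1) * a + k * b - 1"
    have s: "h + (k + 1) * a + k * b = Suc s"
      using False k by (auto simp: s_def)
    \<comment> \<open>\<open>m\<close> counts the \<open>Down\<close> steps and \<open>Suc s\<close>
      all steps. \<open>X\<close> is the common factor of the three contributions; the coefficients
      \<open>a\<close>, \<open>b\<close> and \<open>Suc m\<close> arise from the factorial that
      loses its top factor when the first step is deleted.\<close>
    define m where "m = h + k * a + (k - 1) * b"
    define X :: real where "X = fact s / (fact a * fact b * fact (Suc m))"
    define A where "A = (if a = 0 then {} else (#) Up ` descents k (h + k) (a - 1) b)"
    define B where "B = (if b = 0 then {} else (#) Horiz ` descents k (h + k - 1) a (b - 1))"
    define C where "C = (if h = 0 then {} else (#) Down ` descents k (h - 1) a b)"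
    have split: "descents k h a b = A \<union> B \<union> C"
      using descents_rec[OF False] by (simp only: A_def B_def C_def)
    have A: "finite A \<and> real (card A) = real (h + k + 1) * real a * X"
    proof (cases a)
      case (Suc c)
      have eq: "h + k + (k + 1) * c + k * b = s" "h + k + 1 + k * c + (k - 1) * b = Suc m"
        using s Suc by (simp_all add: m_def)
      show ?thesis
        using less[of "h + k" c b] s Suc unfolding eq
        by (simp add: A_def card_image X_def del: of_nat_Suc)
    qed (simp add: A_def)
    have B: "finite B \<and> real (card B) = real (h + k) * real b * X"
    proof (cases b)
      case (Suc c)
      have eq: "h + k - 1 + (k + 1) * a + k * c = s" "h + k + k * a + (k - 1) * c = Suc m"
        "h + k - 1 + 1 = h + k"
        using s Suc k by (simp_all add: m_def)
      show ?thesis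
        using less[of "h + k - 1" a c] s Suc unfolding eq
        by (simp add: B_def card_image X_def del: of_nat_Suc)
    qed (simp add: B_def)
    have C: "finite C \<and> real (card C) = real h * real (Suc m) * X"
    proof (cases h)
      case (Suc g)
      have eq: "g + (k + 1) * a + k * b = s" "g + 1 + k * a + (k - 1) * b = m"
        using s Suc by (simp_all add: m_def)
      show ?thesis
        using less[of g a b] s Suc unfolding eq
        by (simp add: C_def card_image X_def del: of_nat_Suc)
    qed (simp add: C_def)
    have disj: "A \<inter> B = {}" "(A \<union> B) \<inter> C = {}"
      by (auto simp: A_def B_def C_def)
    have "card (descents k h a b) = card A + card B + card C"
      unfolding split using A B C disj by (simp add: card_Un_disjoint)
    then have "real (card (descents k h a b)) =
        (real (h + k + 1) * real a + real (h + k) * real b + real h * real (Suc m)) * X"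
      using A B C by (simp add: algebra_simps)
    also have "real (h + k + 1) * real a + real (h + k) * real b + real h * real (Suc m) =
        real ((h + k + 1) * a + (h + k) * b + h * Suc m)"
      by (simp add: algebra_simps)
    \<comment> \<open>This is the ballot recursion: on both sides a has coefficient (h + 1)(k + 1),
      b has (h + 1) k, and h (h + 1) remains.\<close>
    also have "(h + k + 1) * a + (h + k) * b + h * Suc m = (h + 1) * Suc s"
      unfolding s[symmetric] m_def k by (simp add: algebra_simps)
    also have "real ((h + 1) * Suc s) * X =
        real (h + 1) * fact (Suc s) / (fact a * fact b * fact (Suc m))"
      by (simp add: X_def algebra_simps)
    finally have "real (card (descents k h a b)) =
        real (h + 1) * fact (Suc s) / (fact a * fact b * fact (Suc m))" .
    moreover have "h + 1 + k * a + (k - 1) * b = Suc m"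
      by (simp add: m_def)
    ultimately show ?thesis
      using A B C split s by simp
  qed
qed

text \<open>The factorials regroup into two binomial coefficients, leaving (n - 1)! / n! = 1 /
  n.\<close>

lemma card_descents_0:
  assumes "k \<ge> 1" and "n \<ge> 1" and "j \<le> n"
  shows "real (card (descents k 0 j (n - j))) =
    1 / real n * (real (n choose j) * real ((k * n + j) choose (n - 1)))"
proof -
  obtain q where k: "k = Suc q"
    using assms by (cases k) auto
  obtain r where n: "n = j + r"
    using assms(3) le_Suc_ex by blast
  have eq: "0 + (k + 1) * j + k * (n - j) = k * n + j"
      "0 + 1 + k * j + (k - 1) * (n - j) = k * n + j - (n - 1)"
    using assms(2) by (simp_all add: n k algebra_simps)
  have le: "n - 1 \<le> k * n + j"
    using k by simp
  have "fact n = real n * fact (n - 1)"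
    using assms(2) by (simp add: fact_reduce)
  then show ?thesis
    using card_descents[OF assms(1), of 0 j "n - j"] assms(2)
    unfolding eq binomial_fact[OF assms(3)] binomial_fact[OF le] by simp
qed

text \<open>The paths are classified by their number \<open>j\<close> of \<open>Up\<close> steps, so
  that the classes are disjoint.\<close>

lemma card_SchB:
  assumes "k \<ge> 1" and "n \<ge> 1"
  shows "real (card (SchB n k)) =
    1 / real n * (\<Sum>j = 0..n. real (n choose j) * real ((k * n + j) choose (n - 1)))"
proof -
  have "SchB n k = (\<Union>j\<in>{0..n}. descents k 0 j (n - j))"
    by (auto simp: SchB_eq[OF assms(1)] descents_def)
  moreover have "card (\<Union>j\<in>{0..n}. descents k 0 j (n - j)) =
      (\<Sum>j = 0..n. card (descents k 0 j (n - j)))"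
    by (rule card_UN_disjoint) (use card_descents[OF assms(1)] in \<open>auto simp: descents_def\<close>)
  ultimately show ?thesis
    using assms by (simp add: card_descents_0 sum_distrib_left)
qed

text \<open>Both sides count pairs I \<subseteq> J of subsets of an n-set with I of size i: choosing
  I first leaves n - i elements free to join J or not.\<close>

lemma sum_choose_mult_choose:
  fixes i n :: nat
  assumes "i \<le> n"
  shows "(\<Sum>j = 0..n. (n choose j) * (j choose i)) = (n choose i) * 2 ^ (n - i)"
proof -
  have "(\<Sum>j = 0..n. (n choose j) * (j choose i)) = (\<Sum>j = i..n. (n choose j) * (j choose i))"
    by (rule sum.mono_neutral_right) auto
  also have "\<dots> = (\<Sum>j = i..n. (n choose i) * ((n - i) choose (j - i)))"
    by (rule sum.cong) (auto simp: choose_mult)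
  also have "\<dots> = (n choose i) * (\<Sum>j\<le>n - i. (n - i) choose j)"
    unfolding sum_distrib_left using assms
    by (intro sum.reindex_bij_witness[of _ "\<lambda>j. j + i" "\<lambda>j. j - i"]) auto
  finally show ?thesis
    by (simp add: choose_row_sum)
qed

text \<open>Vandermonde splits the r chosen elements into m from the N and r - m from the j; after
  exchanging the sums, the inner sum over j is the preceding one with i = r - m.\<close>

lemma sum_choose_mult_choose_add:
  fixes N n r :: nat
  assumes "r \<le> n"
  shows "(\<Sum>j = 0..n. (n choose j) * ((N + j) choose r)) =
    (\<Sum>m = 0..r. 2 ^ (n - (r - m)) * (N choose m) * (n choose (r - m)))"
proof -
  have "(\<Sum>j = 0..n. (n choose j) * ((N + j) choose r)) =
      (\<Sum>j = 0..n. \<Sum>m = 0..r. (N choose m) * ((n choose j) * (j choose (r - m))))"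
    by (simp add: vandermonde[symmetric] sum_distrib_left atMost_atLeast0 mult_ac)
  also have "\<dots> = (\<Sum>m = 0..r. (N choose m) * (\<Sum>j = 0..n. (n choose j) * (j choose (r - m))))"
    by (subst sum.swap) (simp add: sum_distrib_left)
  also have "\<dots> = (\<Sum>m = 0..r. 2 ^ (n - (r - m)) * (N choose m) * (n choose (r - m)))"
    using assms by (intro sum.cong) (auto simp: sum_choose_mult_choose)
  finally show ?thesis .
qed

theorem proposition4p11:
  fixes k n :: nat
  assumes "k \<ge> 1" and "n \<ge> 1"
  shows "real (card (SchB n k)) =
           1 / real n * (\<Sum>m = 0..n - 1. 2 ^ (m + 1) * real ((n * k) choose m) * real (n choose (n - m - 1)))
       \<and> real (card (SchB n k)) =
           1 / real n * (\<Sum>j = 0..n. real (n choose j) * real ((k * n + j) choose (n - 1)))"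
proof -
  have "(\<Sum>j = 0..n. (n choose j) * ((k * n + j) choose (n - 1))) =
      (\<Sum>m = 0..n - 1. 2 ^ (n - (n - 1 - m)) * ((k * n) choose m) * (n choose (n - 1 - m)))"
    by (rule sum_choose_mult_choose_add) simp
  also have "\<dots> = (\<Sum>m = 0..n - 1. 2 ^ (m + 1) * ((n * k) choose m) * (n choose (n - m - 1)))"
  proof (rule sum.cong)
    fix m assume "m \<in> {0..n - 1}"
    \<comment> \<open>Here n \<ge> 1 and m \<le> n - 1 keep the natural subtractions exact, which
      gives the exponent m + 1.\<close>
    then have "n - (n - 1 - m) = m + 1" "n - 1 - m = n - m - 1"
      using assms(2) by auto
    then show "2 ^ (n - (n - 1 - m)) * ((k * n) choose m) * (n choose (n - 1 - m)) =
        2 ^ (m + 1) * ((n * k) choose m) * (n choose (n - m - 1))"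
      by (simp only: mult.commute[of k n])
  qed simp
  finally have "real (\<Sum>j = 0..n. (n choose j) * ((k * n + j) choose (n - 1))) =
      real (\<Sum>m = 0..n - 1. 2 ^ (m + 1) * ((n * k) choose m) * (n choose (n - m - 1)))"
    by (rule arg_cong)
  then show ?thesis
    using card_SchB[OF assms] by simp
qed

end
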